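(* Let $I=[a,b]\subset\mathbb{R}$ be a closed bounded interval ($a<b$) and let $\varphi\in\Phi_{\mathrm w}(I)$. If $f\in\mathrm{RBV}^\varphi(I)$ is absolutely continuous on $I$, then $f'\in L^\varphi(I)$ and $$\|f'\|_{L^\varphi(I)}\le\|f\|_{\mathrm{RBV}^\varphi(I)}.$$
   Context: $\Phi_{\mathrm w}(I)$ is the set of functions $\varphi:I\times[0,\infty)\to[0,\infty]$ such that: $x\mapsto\varphi(x,|g(x)|)$ is measurable for every measurable $g:I\to\mathbb{R}$; for every $x\in I$, $t\mapsto\varphi(x,t)$ is non-decreasing with $\varphi(x,0)=\lim_{t\to0^+}\varphi(x,t)=0$ and $\lim_{t\to\infty}\varphi(x,t)=\infty$; and there is $L\ge1$, independent of $x$, with $\frac{\varphi(x,s)}{s}\le L\frac{\varphi(x,t)}{t}$ for all $0<s<t$ and $x\in I$. For measurable $g$, $\varrho_\varphi(g):=\int_I\varphi(x,|g(x)|)\,dx$; $L^\varphi(I)$ is the set of measurable $g$ with $\lim_{\lambda\to0^+}\varrho_\varphi(\lambda g)=0$, and $\|g\|_{L^\varphi(I)}:=\inf\{\lambda>0\mid\varrho_\varphi(g/\lambda)\le1\}$. For $A\subset I$ let $\varphi^+_A(t):=\sup_{x\in A}\varphi(x,t)$. A partition $(I_k)_{k=1}^n$ of $I$ is a finite family of non-degenerate closed intervals with disjoint interiors and union $I$. For $I_k=[a_k,b_k]$, $\Delta_kf:=f(a_k)-f(b_k)$. Define $$\mathrm V^\varphi_I(f):=\sup_{(I_k)}\sum_{k=1}^n\varphi^+_{I_k}\Big(\frac{|\Delta_kf|}{|I_k|}\Big)|I_k|$$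 (supremum over all partitions), $\mathrm{RBV}^\varphi(I):=\{f:I\to\mathbb{R}\mid\lim_{\lambda\to0}\mathrm V^\varphi_I(\lambda f)=0\}$ and $\|f\|_{\mathrm{RBV}^\varphi(I)}:=\inf\{\lambda>0\mid\mathrm V^\varphi_I(f/\lambda)\le1\}$. *)

theory Defs
  imports "HOL-Analysis.Analysis"
begin

(* A function \<phi> : I x [0,\<infinity>) \<rightarrow> [0,\<infinity>] is a total function real \<Rightarrow> real \<Rightarrow> ennreal of which only the
   values \<phi> x t with x \<in> I and t \<ge> 0 are ever constrained or used; likewise a function on I is a
   total function on the reals.  Measurability is Lebesgue measurability throughout. *)

definition Phi_w :: "real set \<Rightarrow> (real \<Rightarrow> real \<Rightarrow> ennreal) set" where
  "Phi_w I = {\<phi>.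
     (\<forall>g::real \<Rightarrow> real. g \<in> borel_measurable (lebesgue_on I) \<longrightarrow>
        (\<lambda>x. \<phi> x \<bar>g x\<bar>) \<in> borel_measurable (lebesgue_on I)) \<and>
     (\<forall>x\<in>I. mono_on {0..} (\<phi> x) \<and> \<phi> x 0 = 0 \<and>
        (\<phi> x \<longlongrightarrow> 0) (at_right 0) \<and> (\<phi> x \<longlongrightarrow> \<infinity>) at_top) \<and>
     (\<exists>L::real. L \<ge> 1 \<and> (\<forall>x\<in>I. \<forall>s t. 0 < s \<and> s < t \<longrightarrow>
        \<phi> x s / ennreal s \<le> ennreal L * (\<phi> x t / ennreal t)))}"

definition modular :: "(real \<Rightarrow> real \<Rightarrow> ennreal) \<Rightarrow> real set \<Rightarrow> (real \<Rightarrow> real) \<Rightarrow> ennreal" where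
  "modular \<phi> I g = (\<integral>\<^sup>+x. \<phi> x \<bar>g x\<bar> \<partial>lebesgue_on I)"

definition L_phi :: "(real \<Rightarrow> real \<Rightarrow> ennreal) \<Rightarrow> real set \<Rightarrow> (real \<Rightarrow> real) set" where
  "L_phi \<phi> I = {g. g \<in> borel_measurable (lebesgue_on I) \<and>
     ((\<lambda>c. modular \<phi> I (\<lambda>x. c * g x)) \<longlongrightarrow> 0) (at_right 0)}"

(* The two norms take values in [0,\<infinity>], so that the infimum of the empty set is \<infinity>. *)

definition norm_L_phi :: "(real \<Rightarrow> real \<Rightarrow> ennreal) \<Rightarrow> real set \<Rightarrow> (real \<Rightarrow> real) \<Rightarrow> ennreal" where
  "norm_L_phi \<phi> I g = Inf {ennreal c |c. c > 0 \<and> modular \<phi> I (\<lambda>x. g x / c) \<le> 1}"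

definition phi_plus :: "(real \<Rightarrow> real \<Rightarrow> ennreal) \<Rightarrow> real set \<Rightarrow> real \<Rightarrow> ennreal" where
  "phi_plus \<phi> A t = (SUP x\<in>A. \<phi> x t)"

(* A division may contain one-point intervals; these are excluded by the condition on the measure.
   Distinct members of an indexed partition are distinct sets, so a set of intervals suffices. *)
definition partitions :: "real set \<Rightarrow> real set set set" where
  "partitions I = {D. D division_of I \<and> (\<forall>K\<in>D. measure lborel K > 0)}"

(* The increment f(a) - f(b) over K = [a,b]. *)
definition increment :: "(real \<Rightarrow> real) \<Rightarrow> real set \<Rightarrow> real" where
  "increment f K = f (Inf K) - f (Sup K)"

definition V_phi :: "(real \<Rightarrow> real \<Rightarrow> ennreal) \<Rightarrow> real set \<Rightarrow> (real \<Rightarrow> real) \<Rightarrow> ennreal" where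
  "V_phi \<phi> I f = (SUP D\<in>partitions I.
     \<Sum>K\<in>D. phi_plus \<phi> K (\<bar>increment f K\<bar> / measure lborel K) * ennreal (measure lborel K))"

definition RBV :: "(real \<Rightarrow> real \<Rightarrow> ennreal) \<Rightarrow> real set \<Rightarrow> (real \<Rightarrow> real) set" where
  "RBV \<phi> I = {f. ((\<lambda>c. V_phi \<phi> I (\<lambda>x. c * f x)) \<longlongrightarrow> 0) (at 0)}"

definition norm_RBV :: "(real \<Rightarrow> real \<Rightarrow> ennreal) \<Rightarrow> real set \<Rightarrow> (real \<Rightarrow> real) \<Rightarrow> ennreal" where
  "norm_RBV \<phi> I f = Inf {ennreal c |c. c > 0 \<and> V_phi \<phi> I (\<lambda>x. f x / c) \<le> 1}"

(* The usual epsilon-delta definition; D ranges over the finite families of non-overlapping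
   closed intervals contained in I. *)
definition abs_continuous_on :: "real set \<Rightarrow> (real \<Rightarrow> real) \<Rightarrow> bool" where
  "abs_continuous_on I f \<longleftrightarrow>
     (\<forall>\<epsilon>>0. \<exists>\<delta>>0. \<forall>D. D division_of \<Union>D \<and> \<Union>D \<subseteq> I \<and> (\<Sum>K\<in>D. measure lborel K) < \<delta> \<longrightarrow>
        (\<Sum>K\<in>D. \<bar>increment f K\<bar>) < \<epsilon>)"

(* For f absolutely continuous on [a,b], the derivative exists at almost every interior point
   and is represented there by the library function deriv f, which depends only on f restricted
   to [a,b]; its values on the remaining null set (including a and b) affect neither membership
   in L_phi nor norm_L_phi. *)

end

theory Submission
  imports Defs
begin

text \<open>On the uniform partition into \<open>n + 1\<close> intervals let \<open>q\<^sub>n\<close> be the step function of difference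
  quotients of \<open>f\<close>. Each \<open>\<phi> x \<bar>q\<^sub>n x\<bar>\<close> is bounded on its interval by the supremum in the variation,
  so its integral is at most the variation of \<open>f\<close>. Since \<open>\<bar>q\<^sub>n\<bar>\<close> tends to \<open>\<bar>f'\<bar>\<close> almost everywhere,
  Fatou's lemma bounds the modular of \<open>c' f'\<close> by the variation of \<open>c f\<close> for all \<open>c' < c\<close>.

  That \<open>f\<close> is differentiable almost everywhere follows from Vitali's covering theorem. If at every
  point of \<open>E\<close> there are arbitrarily small intervals of slope less than \<open>p\<close> and of slope
  greater than \<open>q > p\<close>, cover \<open>E\<close> by disjoint intervals of the first kind, and within these by
  disjoint intervals of the second kind. Both families have total length close to the measure of \<open>E\<close>,
  so what the second leaves out of the first is short and, by absolute continuity, contributes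
  little to the increments of \<open>f\<close>; hence \<open>q |E| \<le> p |E|\<close> and \<open>E\<close> is a null set.\<close>

subsection \<open>Vitali coverings by intervals\<close>

lemma increment_Icc: "u \<le> v \<Longrightarrow> increment f {u..v} = f u - f v"
  by (simp add: increment_def)

text \<open>Telescoping: \<open>increment f\<close> is additive when an interval is cut in two,
  hence over every division.\<close>

lemma sum_increment_division:
  fixes u v :: real
  assumes "u \<le> v" "\<D> division_of {u..v}"
  shows "(\<Sum>K\<in>\<D>. increment f K) = f u - f v"
proof -
  \<comment> \<open>An additive interval function must vanish on the empty set, where
    \<open>increment f\<close> has an unspecified value.\<close>
  let ?g = "\<lambda>K. if K = {} then 0 else increment f K"
  interpret operative_real plus 0 ?g
    rewrites "comm_monoid_set.F (+) 0 = sum"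
    by standard[1] (auto simp: sum_def increment_def)
  have "(\<Sum>K\<in>\<D>. increment f K) = sum ?g \<D>"
    using assms(2) by (intro sum.cong) auto
  also have "\<dots> = f u - f v"
    using division[of \<D> u v] assms by (simp add: increment_Icc)
  finally show ?thesis .
qed

lemma sum_measure_division:
  fixes \<D> :: "real set set"
  assumes "\<D> division_of S"
  shows "(\<Sum>K\<in>\<D>. measure lborel K) = measure lebesgue S"
proof -
  have "measure lborel K = measure lebesgue K" if "K \<in> \<D>" for K
    using division_ofD(4)[OF assms that] by (auto simp: measure_completion)
  then show ?thesis
    using content_division[OF assms] by simp
qed

text \<open>The strict inequalities make the set of straddled points a countable intersection of open
  sets, whatever \<open>Q\<close> is.\<close>

definition straddled :: "(real \<Rightarrow> real \<Rightarrow> bool) \<Rightarrow> real \<Rightarrow> bool" where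
  "straddled Q x \<longleftrightarrow> (\<forall>d>0. \<exists>u v. u < x \<and> x < v \<and> v - u < d \<and> Q u v)"

lemma borel_straddled: "{x. straddled Q x} \<in> sets borel"
proof -
  let ?U = "\<lambda>n::nat. \<Union>{{u<..<v} |u v. v - u < 1 / Suc n \<and> Q u v}"
  have "{x. straddled Q x} = (\<Inter>n. ?U n)"
  proof (intro set_eqI iffI)
    fix x assume "x \<in> {x. straddled Q x}"
    then have *: "\<exists>u v. u < x \<and> x < v \<and> v - u < 1 / Suc n \<and> Q u v" for n :: nat
      by (simp add: straddled_def)
    show "x \<in> (\<Inter>n. ?U n)"
    proof
      fix n
      obtain u v where "u < x" "x < v" "v - u < 1 / Suc n" "Q u v"
        using *[of n] by auto
      then show "x \<in> ?U n"
        by (intro UnionI[of "{u<..<v}"]) auto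
    qed
  next
    fix x assume x: "x \<in> (\<Inter>n. ?U n)"
    show "x \<in> {x. straddled Q x}"
      unfolding straddled_def mem_Collect_eq
    proof (intro allI impI)
      fix d :: real assume "d > 0"
      then obtain n where n: "1 / Suc n < d"
        using nat_approx_posE by blast
      from x have "x \<in> ?U n" by blast
      then obtain u v where "u < x" "x < v" "v - u < 1 / Suc n" "Q u v"
        by auto
      with n show "\<exists>u v. u < x \<and> x < v \<and> v - u < d \<and> Q u v"
        by (intro exI[of _ u] exI[of _ v]) auto
    qed
  qed
  moreover have "open (?U n)" for n
    by (intro open_Union) auto
  then have "(\<Inter>n. ?U n) \<in> sets borel"
    by (intro sets.countable_INT) auto
  ultimately show ?thesis by simp
qed

text \<open>Vitali's theorem exhausts \<open>S\<close> up to a null set by countably many disjoint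
  intervals, and finitely many of these already carry all but less than \<open>e\<close> of their
  total measure. Openness of \<open>W\<close> leaves room for short intervals inside it around each
  point of \<open>S\<close>.\<close>

lemma Vitali_division:
  fixes Q :: "real \<Rightarrow> real \<Rightarrow> bool"
  assumes S: "S \<in> lmeasurable" "S \<subseteq> W" and W: "open W" "W \<in> lmeasurable"
    and Q: "\<And>x. x \<in> S \<Longrightarrow> straddled Q x" and "e > 0"
  obtains \<D> where "\<D> division_of \<Union>\<D>" "\<Union>\<D> \<subseteq> W" "pairwise disjnt \<D>"
    "\<And>K. K \<in> \<D> \<Longrightarrow> \<exists>u v. K = {u..v} \<and> u < v \<and> Q u v" "measure lebesgue (S - \<Union>\<D>) < e"
proof -
  define I where "I = {(u, v). u < v \<and> Q u v \<and> {u..v} \<subseteq> W}"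
  \<comment> \<open>The covering theorem speaks of closed balls, so an interval is passed to it as
    midpoint and half-length.\<close>
  define m where "m = (\<lambda>(u::real, v). (u + v) / 2)"
  define r where "r = (\<lambda>(u::real, v). (v - u) / 2)"
  have cb: "cball (m i) (r i) = {fst i..snd i}" for i
    by (cases i) (auto simp: m_def r_def cball_eq_atLeastAtMost field_simps)
  obtain C where C: "countable C" "C \<subseteq> I"
    "pairwise (\<lambda>i j. disjnt (cball (m i) (r i)) (cball (m j) (r j))) C"
    "negligible (S - (\<Union>i\<in>C. cball (m i) (r i)))"
  proof (rule Vitali_covering_theorem_cballs[of I r S m])
    show "0 < r i" if "i \<in> I" for i
      using that by (auto simp: I_def r_def)
    fix x d :: real assume "x \<in> S" "0 < d"
    moreover obtain d' where "d' > 0" and d': "ball x d' \<subseteq> W"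
      using W(1) S(2) \<open>x \<in> S\<close> by (meson open_contains_ball subset_iff)
    ultimately obtain u v where uv: "u < x" "x < v" "v - u < min d d'" "Q u v"
      using Q[OF \<open>x \<in> S\<close>] unfolding straddled_def by (metis min_less_iff_conj)
    have "{u..v} \<subseteq> ball x d'"
      using uv by (auto simp: dist_real_def)
    with d' uv have "(u, v) \<in> I" by (auto simp: I_def)
    then show "\<exists>i. i \<in> I \<and> x \<in> cball (m i) (r i) \<and> r i < d"
      using uv by (intro exI[of _ "(u, v)"]) (auto simp: cb, auto simp: r_def)
  qed
  let ?J = "\<lambda>i::real \<times> real. {fst i..snd i}"
  have CI: "fst i < snd i \<and> Q (fst i) (snd i) \<and> ?J i \<subseteq> W" if "i \<in> C" for i
    using that C(2) by (cases i) (fastforce simp: I_def)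
  have U: "\<Union>(?J ` C) \<subseteq> W" using CI by auto
  have fin: "\<Union>D' \<in> lmeasurable" if "D' \<subseteq> ?J ` C" "finite D'" for D'
    using that by (intro fmeasurable.finite_Union) auto
  obtain \<D> where D: "\<D> \<subseteq> ?J ` C" "finite \<D>"
    "measure lebesgue (\<Union>(?J ` C)) - e < measure lebesgue (\<Union>\<D>)"
  proof (rule measure_countable_Union_approachable[of "?J ` C" e "measure lebesgue W"])
    show "measure lebesgue (\<Union>D') \<le> measure lebesgue W" if "D' \<subseteq> ?J ` C" "finite D'" for D'
    proof (rule measure_mono_fmeasurable)
      show "\<Union>D' \<subseteq> W" using U that(1) by blast
    qed (use fin[OF that] W in auto)
  qed (use C \<open>e > 0\<close> in auto)
  have Dex: "\<exists>i\<in>C. K = ?J i" if "K \<in> \<D>" for K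
    using that D(1) by auto
  have Dsub: "\<Union>\<D> \<subseteq> \<Union>(?J ` C)" using D(1) by auto
  have "\<Union>(?J ` C) \<in> sets lebesgue"
    using C(1) by (intro sets.countable_UN'') auto
  then have meas: "\<Union>(?J ` C) \<in> lmeasurable" "\<Union>\<D> \<in> lmeasurable"
    using U W(2) fin[OF D(1,2)] fmeasurableI2 by blast+
  have pw: "pairwise disjnt \<D>"
    unfolding pairwise_def
  proof (intro ballI impI)
    fix K L assume "K \<in> \<D>" "L \<in> \<D>" "K \<noteq> L"
    moreover obtain i j where "i \<in> C" "K = ?J i" "j \<in> C" "L = ?J j"
      using Dex \<open>K \<in> \<D>\<close> \<open>L \<in> \<D>\<close> by metis
    ultimately show "disjnt K L"
      using pairwiseD[OF C(3), of i j] by (auto simp only: cb)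
  qed
  show thesis
  proof
    show "\<Union>\<D> \<subseteq> W" using Dsub U by blast
    show "pairwise disjnt \<D>" by fact
    show ex: "\<exists>u v. K = {u..v} \<and> u < v \<and> Q u v" if "K \<in> \<D>" for K
      using Dex[OF that] CI by blast
    show "\<D> division_of \<Union>\<D>"
    proof (rule division_ofI)
      show "K \<noteq> {}" "\<exists>u v. K = cbox u v" if "K \<in> \<D>" for K
        using ex[OF that] by auto
      fix K L assume "K \<in> \<D>" "L \<in> \<D>" "K \<noteq> L"
      then have "K \<inter> L = {}" using pw by (simp add: pairwise_def disjnt_def)
      then show "interior K \<inter> interior L = {}" using interior_subset by blast
    qed (use D(2) in auto)
    have "measure lebesgue (S - \<Union>\<D>)
        \<le> measure lebesgue ((S - \<Union>(?J ` C)) \<union> (\<Union>(?J ` C) - \<Union>\<D>))"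
      using S meas by (intro measure_mono_fmeasurable) (auto intro!: fmeasurable.Un fmeasurable.Diff)
    also have "\<dots> \<le> measure lebesgue (S - \<Union>(?J ` C)) + measure lebesgue (\<Union>(?J ` C) - \<Union>\<D>)"
      using S meas by (intro measure_Un_le) auto
    also have "measure lebesgue (S - \<Union>(?J ` C)) = 0"
      using C(4) by (simp add: cb negligible_imp_measure0)
    also have "measure lebesgue (\<Union>(?J ` C) - \<Union>\<D>)
        = measure lebesgue (\<Union>(?J ` C)) - measure lebesgue (\<Union>\<D>)"
      using meas Dsub by (intro measurable_measure_Diff) auto
    finally show "measure lebesgue (S - \<Union>\<D>) < e" using D(3) by simp
  qed
qed

subsection \<open>Almost everywhere differentiability\<close>

lemma abs_continuous_on_uminus:
  "abs_continuous_on I f \<Longrightarrow> abs_continuous_on I (\<lambda>x. - f x)"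
  by (simp add: abs_continuous_on_def increment_def abs_minus_commute)

text \<open>Absolute continuity is applied to the single interval between \<open>x\<close> and a
  nearby \<open>y\<close>, which stays in \<open>{a..b}\<close> because \<open>x\<close> is
  interior.\<close>

lemma abs_continuous_on_imp_isCont:
  assumes "abs_continuous_on {a..b} f" "a < x" "x < b"
  shows "isCont f x"
  unfolding continuous_at_eps_delta
proof (intro allI impI)
  fix e :: real assume "e > 0"
  then obtain d where "d > 0" and d: "\<And>D. D division_of \<Union>D \<Longrightarrow> \<Union>D \<subseteq> {a..b} \<Longrightarrow>
      (\<Sum>K\<in>D. measure lborel K) < d \<Longrightarrow> (\<Sum>K\<in>D. \<bar>increment f K\<bar>) < e"
    using assms(1) unfolding abs_continuous_on_def by metis
  have "dist (f y) (f x) < e" if y: "dist y x < min d (min (x - a) (b - x))" for y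
  proof -
    let ?K = "{min x y..max x y}"
    have "{?K} division_of ?K"
      using division_of_self[of "min x y" "max x y"] by simp
    moreover have "\<Union>{?K} \<subseteq> {a..b}" "measure lborel ?K < d"
      using y by (auto simp: dist_real_def)
    ultimately have "\<bar>increment f ?K\<bar> < e"
      using d[of "{?K}"] by simp
    then show ?thesis
      by (cases "x \<le> y") (auto simp: increment_Icc dist_real_def)
  qed
  then show "\<exists>d>0. \<forall>x'. dist x' x < d \<longrightarrow> dist (f x') (f x) < e"
    using \<open>d > 0\<close> assms by (intro exI[of _ "min d (min (x - a) (b - x))"]) auto
qed

text \<open>A slope below \<open>p\<close> is expressed as a slope of \<open>- f\<close> above \<open>- p\<close>.\<close>

definition slope_above :: "(real \<Rightarrow> real) \<Rightarrow> real \<Rightarrow> real \<Rightarrow> real \<Rightarrow> real \<Rightarrow> real \<Rightarrow> bool" where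
  "slope_above f a b q u v \<longleftrightarrow> a \<le> u \<and> v \<le> b \<and> q * (v - u) < f v - f u"

lemma straddled_slope_aboveD: "straddled (slope_above f a b q) x \<Longrightarrow> a < x \<and> x < b"
  unfolding straddled_def slope_above_def by (meson le_less_trans less_le_trans zero_less_one)

lemma straddled_mono: "straddled P x \<Longrightarrow> (\<And>u v. u < v \<Longrightarrow> P u v \<Longrightarrow> Q u v) \<Longrightarrow> straddled Q x"
  unfolding straddled_def by (meson less_trans)

lemma slope_above_mono: "u < v \<Longrightarrow> p \<le> q \<Longrightarrow> slope_above f a b q u v \<Longrightarrow> slope_above f a b p u v"
  unfolding slope_above_def by (smt (verit) mult_right_mono)

text \<open>Disjoint intervals of slope above \<open>N\<close> and total length below \<delta> have
  increments summing to less than 1, so their total length is below \<open>1 / N\<close>. As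
  \<open>N\<close> is arbitrary, the set that they nearly cover is null.\<close>

lemma negligible_infinite_slope:
  assumes ac: "abs_continuous_on {a..b} f"
  shows "negligible {x. \<forall>n::nat. straddled (slope_above f a b (real n)) x}" (is "negligible ?E")
proof -
  obtain \<delta> where "\<delta> > 0" and \<delta>: "\<And>D. D division_of \<Union>D \<Longrightarrow> \<Union>D \<subseteq> {a..b} \<Longrightarrow>
      (\<Sum>K\<in>D. measure lborel K) < \<delta> \<Longrightarrow> (\<Sum>K\<in>D. \<bar>increment f K\<bar>) < 1"
    using ac unfolding abs_continuous_on_def by (metis zero_less_one)
  define E where "E = ?E"
  have "E = (\<Inter>n::nat. {x. straddled (slope_above f a b (real n)) x})"
    by (auto simp: E_def)
  moreover have "(\<Inter>n::nat. {x. straddled (slope_above f a b (real n)) x}) \<in> sets borel"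
    using borel_straddled by (intro sets.countable_INT) auto
  ultimately have E: "E \<in> sets borel"
    by simp
  \<comment> \<open>Every disjoint family inside a window of length \<open>\<delta>/2\<close> has
    total length below \<delta>. Windows with rational left end points cover the line, and there are
    countably many of them.\<close>
  let ?W = "\<lambda>c. {c<..<c + \<delta>/2}"
  have neg: "negligible (E \<inter> ?W c)" for c
  proof -
    let ?T = "E \<inter> ?W c"
    have T: "?T \<in> lmeasurable"
      by (rule fmeasurableI2[of "?W c"]) (use E in auto)
    \<comment> \<open>One \<open>1 / Suc n\<close> bounds the chosen intervals, the other what they
      miss.\<close>
    have "measure lebesgue ?T \<le> 2 / Suc n" for n
    proof -
      obtain \<D> where D: "\<D> division_of \<Union>\<D>" "\<Union>\<D> \<subseteq> ?W c" "pairwise disjnt \<D>"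
        "\<And>K. K \<in> \<D> \<Longrightarrow> \<exists>u v. K = {u..v} \<and> u < v \<and> slope_above f a b (Suc n) u v"
        "measure lebesgue (?T - \<Union>\<D>) < 1 / Suc n"
      proof (rule Vitali_division[of ?T "?W c" "slope_above f a b (Suc n)" "1 / Suc n"])
        show "straddled (slope_above f a b (real (Suc n))) x" if "x \<in> ?T" for x
          using that unfolding E_def by blast
      qed (use T in auto)
      have UD: "\<Union>\<D> \<in> lmeasurable"
        using D(1) by (rule lmeasurable_division)
      have "measure lebesgue (\<Union>\<D>) \<le> measure lebesgue (?W c)"
        using D(2) UD by (intro measure_mono_fmeasurable) auto
      then have small: "(\<Sum>K\<in>\<D>. measure lborel K) < \<delta>"
        using \<open>\<delta> > 0\<close> by (simp add: sum_measure_division[OF D(1)])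
      have inc: "Suc n * measure lborel K \<le> \<bar>increment f K\<bar> \<and> K \<subseteq> {a..b}" if "K \<in> \<D>" for K
      proof -
        obtain u v where "K = {u..v}" "u < v" "slope_above f a b (Suc n) u v"
          using D(4)[OF \<open>K \<in> \<D>\<close>] by blast
        then show ?thesis by (auto simp: slope_above_def increment_Icc)
      qed
      have "Suc n * measure lebesgue (\<Union>\<D>) = (\<Sum>K\<in>\<D>. Suc n * measure lborel K)"
        by (simp only: sum_measure_division[OF D(1), symmetric] sum_distrib_left)
      also have "\<dots> \<le> (\<Sum>K\<in>\<D>. \<bar>increment f K\<bar>)"
        using inc by (intro sum_mono) blast
      also have "\<dots> < 1"
        using inc by (intro \<delta> D(1) small) auto
      finally have "measure lebesgue (\<Union>\<D>) \<le> 1 / Suc n"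
        by (simp add: field_simps)
      moreover have "measure lebesgue ?T \<le> measure lebesgue ((?T - \<Union>\<D>) \<union> \<Union>\<D>)"
        using T UD by (intro measure_mono_fmeasurable) auto
      moreover have "\<dots> \<le> measure lebesgue (?T - \<Union>\<D>) + measure lebesgue (\<Union>\<D>)"
        using T UD by (intro measure_Un_le) auto
      ultimately show ?thesis
        using D(5) by simp
    qed
    moreover have "(\<lambda>n. 2 / real (Suc n)) \<longlonglongrightarrow> 0"
      using tendsto_mult_right_zero[OF LIMSEQ_inverse_real_of_nat, of 2] by (simp add: field_simps)
    ultimately have "measure lebesgue ?T \<le> 0"
      by (intro LIMSEQ_le_const) auto
    then have "measure lebesgue ?T = 0"
      by (simp add: measure_nonneg order_antisym)
    then show ?thesis
      using T by (simp add: negligible_iff_measure)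
  qed
  have "E \<subseteq> (\<Union>c\<in>\<rat>. E \<inter> ?W c)"
  proof
    fix x assume "x \<in> E"
    moreover obtain c where "c \<in> \<rat>" "x - \<delta>/2 < c" "c < x"
      using Rats_dense_in_real[of "x - \<delta>/2" x] \<open>\<delta> > 0\<close> by auto
    ultimately show "x \<in> (\<Union>c\<in>\<rat>. E \<inter> ?W c)" by auto
  qed
  moreover have "negligible (\<Union>c\<in>\<rat>. E \<inter> ?W c)"
    using neg countable_rat by (intro negligible_countable_Union) auto
  ultimately have "negligible E"
    using negligible_subset by blast
  then show ?thesis by (simp add: E_def)
qed

lemma negligible_different_slopes:
  assumes ac: "abs_continuous_on {a..b} f" and "p < q"
  shows "negligible {x. straddled (slope_above f a b q) x \<and>
    straddled (slope_above (\<lambda>x. - f x) a b (- p)) x}" (is "negligible ?E")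
proof -
  define E where "E = ?E"
  have "E = {x. straddled (slope_above f a b q) x} \<inter>
      {x. straddled (slope_above (\<lambda>x. - f x) a b (- p)) x}"
    by (auto simp: E_def)
  then have "E \<in> sets borel"
    using borel_straddled by (metis sets.Int)
  moreover have "E \<subseteq> {a..b}"
    using straddled_slope_aboveD unfolding E_def by fastforce
  ultimately have E: "E \<in> lmeasurable"
    using fmeasurableI2[OF lmeasurable_cbox[of a b], of E] by simp
  let ?m = "measure lebesgue E"
  have main: "(q - p) * ?m \<le> 2 * \<epsilon>" if "\<epsilon> > 0" for \<epsilon>
  proof -
    obtain \<delta> where "\<delta> > 0" and \<delta>: "\<And>D. D division_of \<Union>D \<Longrightarrow> \<Union>D \<subseteq> {a..b} \<Longrightarrow>
        (\<Sum>K\<in>D. measure lborel K) < \<delta> \<Longrightarrow> (\<Sum>K\<in>D. \<bar>increment f K\<bar>) < \<epsilon>"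
      using ac \<open>\<epsilon> > 0\<close> unfolding abs_continuous_on_def by metis
    \<comment> \<open>The term \<open>3 * \<bar>q\<bar>\<close> pays for \<open>q * (A - B)\<close>
      with \<open>A - B \<le> 3 * e\<close>, and \<open>2 * (q - p)\<close> for the
      \<open>2 * e\<close> by which \<open>?m\<close> may exceed \<open>A\<close>.\<close>
    define c where "c = 3 * \<bar>q\<bar> + 2 * (q - p)"
    have "c > 0" using \<open>p < q\<close> by (simp add: c_def)
    define e where "e = min (\<delta> / 4) (\<epsilon> / c)"
    have e: "e > 0" "4 * e \<le> \<delta>" "c * e \<le> \<epsilon>"
      using \<open>c > 0\<close> \<open>\<delta> > 0\<close> \<open>\<epsilon> > 0\<close> by (auto simp: e_def min_def field_simps)
    \<comment> \<open>The outer intervals have to stay in an open set barely larger than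
      \<open>E\<close>, so that their total length cannot exceed \<open>?m\<close> by more than
      \<open>e\<close>.\<close>
    obtain G where G: "open G" "E \<subseteq> G" "G - E \<in> lmeasurable" "emeasure lebesgue (G - E) < ennreal e"
      using sets_lebesgue_outer_open[OF fmeasurableD[OF E] e(1)] .
    have Geq: "G = E \<union> (G - E)" using G(2) by blast
    have Gm: "G \<in> lmeasurable"
      by (subst Geq) (intro fmeasurable.Un E G(3))
    have "measure lebesgue (G - E) < e"
      using G(3,4) e(1) by (simp add: emeasure_eq_measure2 ennreal_less_iff)
    then have Gle: "measure lebesgue G \<le> ?m + e"
      using measure_Un_le[of E lebesgue "G - E"] E G(3) Geq by force
    obtain \<I> where I: "\<I> division_of \<Union>\<I>" "\<Union>\<I> \<subseteq> G" "pairwise disjnt \<I>"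
      "\<And>K. K \<in> \<I> \<Longrightarrow> \<exists>u v. K = {u..v} \<and> u < v \<and> slope_above (\<lambda>x. - f x) a b (- p) u v"
      "measure lebesgue (E - \<Union>\<I>) < e"
      by (rule Vitali_division[OF E G(2,1) Gm _ e(1), of "slope_above (\<lambda>x. - f x) a b (- p)"])
        (auto simp: E_def)
    have finI: "finite \<I>" using I(1) by blast
    have Iab: "K \<subseteq> {a..b}" if "K \<in> \<I>" for K
      using I(4)[OF that] by (auto simp: slope_above_def)
    \<comment> \<open>The error \<open>e\<close> is shared among the outer intervals; the
      \<open>+ 1\<close> covers the case of an empty family.\<close>
    define e' where "e' = e / (card \<I> + 1)"
    have "e' > 0" using e(1) by (simp add: e'_def add_nonneg_pos)
    \<comment> \<open>The inner covering needs an open set around its points; passing to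
      \<open>interior K\<close> loses only the two end points of \<open>K\<close>.\<close>
    have "\<exists>D. D division_of \<Union>D \<and> \<Union>D \<subseteq> interior K \<and>
        (\<forall>J\<in>D. \<exists>u v. J = {u..v} \<and> u < v \<and> slope_above f a b q u v) \<and>
        measure lebesgue (E \<inter> interior K - \<Union>D) < e'" if "K \<in> \<I>" for K
    proof -
      have "interior K \<in> lmeasurable"
        using I(4)[OF that] by auto
      then have meas: "E \<inter> interior K \<in> lmeasurable" "interior K \<in> lmeasurable"
        using E by auto
      have str: "straddled (slope_above f a b q) x" if "x \<in> E \<inter> interior K" for x
        using that by (simp add: E_def)
      obtain D where "D division_of \<Union>D" "\<Union>D \<subseteq> interior K" "pairwise disjnt D"
        "\<And>J. J \<in> D \<Longrightarrow> \<exists>u v. J = {u..v} \<and> u < v \<and> slope_above f a b q u v"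
        "measure lebesgue (E \<inter> interior K - \<Union>D) < e'"
        by (rule Vitali_division[OF meas(1) Int_lower2 open_interior meas(2) str \<open>e' > 0\<close>]) (assumption, rule that)
      then show ?thesis by blast
    qed
    then obtain JJ where JJ: "\<And>K. K \<in> \<I> \<Longrightarrow> JJ K division_of \<Union>(JJ K)"
      "\<And>K. K \<in> \<I> \<Longrightarrow> \<Union>(JJ K) \<subseteq> interior K"
      "\<And>K J. K \<in> \<I> \<Longrightarrow> J \<in> JJ K \<Longrightarrow> \<exists>u v. J = {u..v} \<and> u < v \<and> slope_above f a b q u v"
      "\<And>K. K \<in> \<I> \<Longrightarrow> measure lebesgue (E \<inter> interior K - \<Union>(JJ K)) < e'"
      by metis
    \<comment> \<open>Filling the gaps between the inner intervals gives a division of all of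
      \<open>K\<close>, over which increments telescope. The gap pieces are collected in
      \<open>R\<close>.\<close>
    have "\<exists>D. JJ K \<subseteq> D \<and> D division_of K" if "K \<in> \<I>" for K
    proof -
      have "\<exists>u v. K = cbox u v" using division_ofD(4)[OF I(1) that] by blast
      then obtain u v where K: "K = cbox u v" by blast
      have "\<Union>(JJ K) \<subseteq> cbox u v"
        using JJ(2)[OF that] interior_subset K by blast
      then show ?thesis
        using partial_division_extend_interval[OF JJ(1)[OF that]] K by metis
    qed
    then obtain QQ where QQ: "\<And>K. K \<in> \<I> \<Longrightarrow> JJ K \<subseteq> QQ K" "\<And>K. K \<in> \<I> \<Longrightarrow> QQ K division_of K"
      by metis
    have finQ: "finite (QQ K)" "finite (JJ K)" if "K \<in> \<I>" for K
      using QQ(2)[OF that] JJ(1)[OF that] by (simp_all add: division_of_finite)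
    define R where "R = (\<Union>K\<in>\<I>. QQ K - JJ K)"
    have sumR: "(\<Sum>L\<in>R. g L) = (\<Sum>K\<in>\<I>. (\<Sum>L\<in>QQ K. g L) - (\<Sum>L\<in>JJ K. g L))" for g :: "real set \<Rightarrow> real"
    proof -
      have "(\<Sum>L\<in>R. g L) = (\<Sum>K\<in>\<I>. \<Sum>L\<in>QQ K - JJ K. g L)"
        unfolding R_def
      proof (rule sum.UNION_disjoint)
        \<comment> \<open>Pieces belonging to different outer intervals are distinct sets: they are
          non-empty and the outer intervals are disjoint.\<close>
        show "\<forall>K\<in>\<I>. \<forall>L\<in>\<I>. K \<noteq> L \<longrightarrow> (QQ K - JJ K) \<inter> (QQ L - JJ L) = {}"
        proof (intro ballI impI equals0I)
          fix K L M assume *: "K \<in> \<I>" "L \<in> \<I>" "K \<noteq> L" "M \<in> (QQ K - JJ K) \<inter> (QQ L - JJ L)"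
          then have "M \<subseteq> K" "M \<subseteq> L" "M \<noteq> {}"
            using division_ofD(2,3)[OF QQ(2)[OF *(1)]] division_ofD(2)[OF QQ(2)[OF *(2)]] by auto
          moreover have "K \<inter> L = {}"
            using pairwiseD[OF I(3) *(1-3)] by (simp add: disjnt_def)
          ultimately show False by blast
        qed
      qed (use finI finQ in auto)
      also have "\<dots> = (\<Sum>K\<in>\<I>. (\<Sum>L\<in>QQ K. g L) - (\<Sum>L\<in>JJ K. g L))"
        using QQ(1) finQ by (intro sum.cong sum_diff) auto
      finally show ?thesis .
    qed
    have Rex: "\<exists>K\<in>\<I>. L \<in> QQ K" if "L \<in> R" for L
      using that by (auto simp: R_def)
    have Rdiv: "R division_of \<Union>R"
    proof (rule division_ofI)
      show "finite R" using finI finQ by (auto simp: R_def)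
      show "L \<noteq> {}" "\<exists>u v. L = cbox u v" if "L \<in> R" for L
        using Rex[OF that] QQ(2) division_ofD(3,4) by blast+
      fix L M assume LM: "L \<in> R" "M \<in> R" "L \<noteq> M"
      then obtain K K' where K: "K \<in> \<I>" "L \<in> QQ K" "K' \<in> \<I>" "M \<in> QQ K'"
        using Rex by metis
      show "interior L \<inter> interior M = {}"
      proof (cases "K = K'")
        case True
        then show ?thesis using K LM division_ofD(5)[OF QQ(2)] by blast
      next
        case False
        then have "K \<inter> K' = {}"
          using I(3) K by (simp add: pairwise_def disjnt_def)
        moreover have "L \<subseteq> K" "M \<subseteq> K'"
          using K division_ofD(2)[OF QQ(2)] by blast+
        ultimately show ?thesis using interior_subset by blast
      qed
    qed auto
    define A where "A = (\<Sum>K\<in>\<I>. measure lborel K)"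
    define B where "B = (\<Sum>K\<in>\<I>. \<Sum>J\<in>JJ K. measure lborel J)"
    have "(\<Sum>K\<in>\<I>. \<Sum>L\<in>QQ K. measure lborel L) = A"
      unfolding A_def
    proof (rule sum.cong)
      fix K assume K: "K \<in> \<I>"
      have "measure lborel K = measure lebesgue K"
        using I(4)[OF K] by auto
      then show "(\<Sum>L\<in>QQ K. measure lborel L) = measure lborel K"
        using sum_measure_division[OF QQ(2)[OF K]] by simp
    qed simp
    then have RAB: "(\<Sum>L\<in>R. measure lborel L) = A - B"
      by (simp add: sumR sum_subtractf B_def)
    have "A = measure lebesgue (\<Union>\<I>)"
      using sum_measure_division[OF I(1)] by (simp add: A_def)
    also have "\<dots> \<le> measure lebesgue G"
      using lmeasurable_division[OF I(1)] Gm I(2) by (intro measure_mono_fmeasurable) auto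
    finally have A: "A \<le> ?m + e" using Gle by simp
    have B: "?m \<le> B + 2 * e"
    proof -
      \<comment> \<open>A point of \<open>E\<close> is missed by the outer family, or missed by the
        inner one, or is an end point of some \<open>K\<close>, or lies in an inner interval. The
        first two groups cost at most \<open>e\<close> each, the end points nothing, the last at
        most \<open>B\<close>.\<close>
      let ?H = "\<lambda>K. (E \<inter> interior K - \<Union>(JJ K)) \<union> (K - interior K)"
      have JJm: "\<Union>(JJ K) \<in> lmeasurable" if "K \<in> \<I>" for K
        using lmeasurable_division[OF JJ(1)[OF that]] .
      have IK: "K \<in> lmeasurable" "interior K \<in> lmeasurable" "negligible (K - interior K)" if K: "K \<in> \<I>" for K
      proof -
        obtain u v where K: "K = {u..v}" using I(4)[OF K] by blast
        have "K - interior K \<subseteq> {u, v}" by (auto simp: K)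
        then show "negligible (K - interior K)"
          using negligible_subset[of "{u, v}"] by simp
      qed (use I(4)[OF K] in auto)
      have H1: "E \<inter> interior K - \<Union>(JJ K) \<in> lmeasurable" if "K \<in> \<I>" for K
        using fmeasurable.Diff[OF fmeasurable.Int[OF E IK(2)[OF that]] JJm[OF that]] .
      have H2: "K - interior K \<in> lmeasurable" if "K \<in> \<I>" for K
        using negligible_imp_measurable[OF IK(3)[OF that]] .
      have Hm: "?H K \<in> lmeasurable" if "K \<in> \<I>" for K
        using H1[OF that] H2[OF that] by (rule fmeasurable.Un)
      have Hle: "measure lebesgue (?H K) \<le> e'" if "K \<in> \<I>" for K
      proof -
        have "measure lebesgue (?H K) \<le>
            measure lebesgue (E \<inter> interior K - \<Union>(JJ K)) + measure lebesgue (K - interior K)"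
          using H1[OF that] H2[OF that] by (intro measure_Un_le fmeasurableD)
        then show ?thesis
          using JJ(4)[OF that] negligible_imp_measure0[OF IK(3)[OF that]] by simp
      qed
      have sub: "E \<subseteq> (E - \<Union>\<I>) \<union> ((\<Union>K\<in>\<I>. ?H K) \<union> (\<Union>K\<in>\<I>. \<Union>(JJ K)))"
        by blast
      have m1: "(\<Union>K\<in>\<I>. ?H K) \<in> lmeasurable"
        using finI Hm by (rule fmeasurable.finite_UN)
      have m2: "(\<Union>K\<in>\<I>. \<Union>(JJ K)) \<in> lmeasurable"
        using finI JJm by (rule fmeasurable.finite_UN)
      have m3: "E - \<Union>\<I> \<in> lmeasurable"
        using fmeasurable.Diff[OF E lmeasurable_division[OF I(1)]] .
      have "?m \<le> measure lebesgue ((E - \<Union>\<I>) \<union> ((\<Union>K\<in>\<I>. ?H K) \<union> (\<Union>K\<in>\<I>. \<Union>(JJ K))))"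
        using sub fmeasurableD[OF E] fmeasurable.Un[OF m3 fmeasurable.Un[OF m1 m2]]
        by (rule measure_mono_fmeasurable)
      also have "\<dots> \<le> measure lebesgue (E - \<Union>\<I>)
          + measure lebesgue ((\<Union>K\<in>\<I>. ?H K) \<union> (\<Union>K\<in>\<I>. \<Union>(JJ K)))"
        using m1 m2 m3 by (intro measure_Un_le sets.Un fmeasurableD)
      also have "measure lebesgue ((\<Union>K\<in>\<I>. ?H K) \<union> (\<Union>K\<in>\<I>. \<Union>(JJ K)))
          \<le> measure lebesgue (\<Union>K\<in>\<I>. ?H K) + measure lebesgue (\<Union>K\<in>\<I>. \<Union>(JJ K))"
        using m1 m2 by (intro measure_Un_le fmeasurableD)
      also have "measure lebesgue (\<Union>K\<in>\<I>. ?H K) \<le> (\<Sum>K\<in>\<I>. measure lebesgue (?H K))"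
        using finI Hm by (intro measure_UNION_le fmeasurableD)
      also have "(\<Sum>K\<in>\<I>. measure lebesgue (?H K)) \<le> card \<I> * e'"
        using Hle by (intro sum_bounded_above)
      also have "card \<I> * e' \<le> e"
        using e(1) by (simp add: e'_def field_simps)
      also have "measure lebesgue (\<Union>K\<in>\<I>. \<Union>(JJ K)) \<le> (\<Sum>K\<in>\<I>. measure lebesgue (\<Union>(JJ K)))"
        using finI JJm by (intro measure_UNION_le fmeasurableD)
      also have "\<dots> = B"
        unfolding B_def using sum_measure_division[OF JJ(1)] by (intro sum.cong) auto
      finally show ?thesis using I(5) by linarith
    qed
    have "\<Union>R \<subseteq> {a..b}"
    proof
      fix x assume "x \<in> \<Union>R"
      then obtain L K where "x \<in> L" "K \<in> \<I>" "L \<in> QQ K" using Rex by blast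
      then show "x \<in> {a..b}" using Iab division_ofD(2)[OF QQ(2)] by blast
    qed
    \<comment> \<open>The gap pieces have total length \<open>A - B \<le> 3 * e\<close>, which is
      below \<delta> since \<open>4 * e \<le> \<delta>\<close>.\<close>
    then have "(\<Sum>L\<in>R. \<bar>increment f L\<bar>) < \<epsilon>"
      using A B e by (intro \<delta> Rdiv) (auto simp: RAB)
    then have R\<epsilon>: "(\<Sum>L\<in>R. increment f L) < \<epsilon>"
      by (smt (verit) sum_mono)
    \<comment> \<open>Since \<open>increment\<close> is left value minus right value, a slope below
      \<open>p\<close> bounds it from below by \<open>- p\<close> times the length, and a slope
      above \<open>q\<close> bounds it from above by \<open>- q\<close> times the length.\<close>
    have "- p * A \<le> (\<Sum>K\<in>\<I>. increment f K)"
      unfolding A_def sum_distrib_left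
    proof (rule sum_mono)
      fix K assume "K \<in> \<I>"
      then obtain u v where "K = {u..v}" "u < v" "slope_above (\<lambda>x. - f x) a b (- p) u v"
        using I(4) by blast
      then show "- p * measure lborel K \<le> increment f K"
        by (auto simp: slope_above_def increment_Icc)
    qed
    also have "\<dots> = (\<Sum>K\<in>\<I>. \<Sum>L\<in>QQ K. increment f L)"
    proof (rule sum.cong)
      fix K assume K: "K \<in> \<I>"
      then obtain u v where "K = {u..v}" "u < v" using I(4) by blast
      then show "increment f K = (\<Sum>L\<in>QQ K. increment f L)"
        using sum_increment_division[of u v "QQ K" f] QQ(2)[OF K] by (simp add: increment_Icc)
    qed simp
    also have "\<dots> = (\<Sum>L\<in>R. increment f L) + (\<Sum>K\<in>\<I>. \<Sum>J\<in>JJ K. increment f J)"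
      by (simp add: sumR sum_subtractf)
    also have "(\<Sum>K\<in>\<I>. \<Sum>J\<in>JJ K. increment f J) \<le> - q * B"
      unfolding B_def sum_distrib_left
    proof (intro sum_mono)
      fix K J assume "K \<in> \<I>" "J \<in> JJ K"
      then obtain u v where "J = {u..v}" "u < v" "slope_above f a b q u v"
        using JJ(3) by blast
      then show "increment f J \<le> - q * measure lborel J"
        by (auto simp: slope_above_def increment_Icc)
    qed
    finally have pq: "q * B - p * A < \<epsilon>" using R\<epsilon> by simp
    have "0 \<le> (\<Sum>L\<in>R. measure lborel L)"
      by (intro sum_nonneg) auto
    then have AB: "0 \<le> A - B" "A - B \<le> 3 * e"
      using A B RAB by auto
    have "(q - p) * ?m \<le> (q - p) * (A + 2 * e)"
      using B AB \<open>p < q\<close> by (intro mult_left_mono) auto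
    also have "\<dots> = (q * B - p * A) + q * (A - B) + 2 * (q - p) * e"
      by (simp add: algebra_simps)
    also have "q * (A - B) \<le> \<bar>q\<bar> * (3 * e)"
      using AB by (intro mult_mono) auto
    finally have "(q - p) * ?m \<le> \<epsilon> + c * e"
      using pq by (simp add: c_def algebra_simps)
    then show ?thesis using e(3) by simp
  qed
  have "(q - p) * ?m \<le> 0"
  proof (rule field_le_epsilon)
    fix e :: real assume "e > 0"
    then show "(q - p) * ?m \<le> 0 + e" using main[of "e / 2"] by simp
  qed
  then have "?m \<le> 0"
    using \<open>p < q\<close> by (simp add: mult_le_0_iff)
  then have "?m = 0"
    by (simp add: measure_nonneg order_antisym)
  then show ?thesis
    using E by (simp add: negligible_iff_measure E_def)
qed

text \<open>Short intervals around \<open>x\<close> have slope at most \<open>q\<close>. Letting the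
  end point on the other side of \<open>x\<close> from \<open>y\<close> tend to \<open>x\<close>,
  continuity carries the bound over to the interval between \<open>x\<close> and
  \<open>y\<close>.\<close>

lemma quotient_le_of_straddling:
  fixes g :: "real \<Rightarrow> real"
  assumes g: "isCont g x" and "a < x" "x < b" and "\<not> straddled (slope_above g a b q) x"
  shows "\<exists>d>0. \<forall>y. y \<noteq> x \<and> dist y x < d \<longrightarrow> (g y - g x) / (y - x) \<le> q"
proof -
  obtain d where "d > 0" and d: "\<And>u v. u < x \<Longrightarrow> x < v \<Longrightarrow> v - u < d \<Longrightarrow> a \<le> u \<Longrightarrow> v \<le> b \<Longrightarrow>
      g v - g u \<le> q * (v - u)"
    using assms(4) unfolding straddled_def slope_above_def by (meson not_le)
  \<comment> \<open>Both end points are within \<open>d / 2\<close> of \<open>x\<close>, so the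
    interval is shorter than \<open>d\<close>; the other bounds keep it inside
    \<open>{a..b}\<close>.\<close>
  define e where "e = min (d / 2) (min (x - a) (b - x))"
  have "e > 0" using \<open>d > 0\<close> assms by (simp add: e_def)
  have lims: "(g \<longlongrightarrow> g x) (at_left x)" "(g \<longlongrightarrow> g x) (at_right x)"
    using g by (auto simp: isCont_def filterlim_at_split)
  have "(g y - g x) / (y - x) \<le> q" if y: "y \<noteq> x" "dist y x < e" for y
  proof (cases "x < y")
    case True
    have "eventually (\<lambda>u. x - e < u \<and> u < x) (at_left x)"
      using eventually_at_left_real[of "x - e" x] \<open>e > 0\<close> by (auto elim: eventually_mono)
    then have "eventually (\<lambda>u. g y - g u \<le> q * (y - u)) (at_left x)"
      by eventually_elim (use True y in \<open>auto intro!: d simp: e_def dist_real_def\<close>)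
    moreover have "((\<lambda>u. g y - g u) \<longlongrightarrow> g y - g x) (at_left x)"
      "((\<lambda>u. q * (y - u)) \<longlongrightarrow> q * (y - x)) (at_left x)"
      using lims by (auto intro!: tendsto_intros)
    ultimately have "g y - g x \<le> q * (y - x)"
      using tendsto_le[OF trivial_limit_at_left_real] by blast
    then show ?thesis using True by (simp add: field_simps)
  next
    case False
    have "eventually (\<lambda>v. x < v \<and> v < x + e) (at_right x)"
      using eventually_at_right_real[of x "x + e"] \<open>e > 0\<close> by (auto elim: eventually_mono)
    then have "eventually (\<lambda>v. g v - g y \<le> q * (v - y)) (at_right x)"
      by eventually_elim (use False y in \<open>auto intro!: d simp: e_def dist_real_def\<close>)
    moreover have "((\<lambda>v. g v - g y) \<longlongrightarrow> g x - g y) (at_right x)"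
      "((\<lambda>v. q * (v - y)) \<longlongrightarrow> q * (x - y)) (at_right x)"
      using lims by (auto intro!: tendsto_intros)
    ultimately have "g x - g y \<le> q * (x - y)"
      using tendsto_le[OF trivial_limit_at_right_real] by blast
    then show ?thesis using False y by (simp add: field_simps)
  qed
  then show ?thesis using \<open>e > 0\<close> by blast
qed

text \<open>All short intervals around \<open>x\<close> have slope at most \<open>q\<close>, hence
  strictly below \<open>r\<close>; symmetric ones serve as witnesses.\<close>

lemma straddled_uminus:
  assumes "\<not> straddled (slope_above f a b q) x" "q < r" "a < x" "x < b"
  shows "straddled (slope_above (\<lambda>x. - f x) a b (- r)) x"
  unfolding straddled_def
proof (intro allI impI)
  fix d' :: real assume "d' > 0"
  obtain d where "d > 0" and d: "\<And>u v. u < x \<Longrightarrow> x < v \<Longrightarrow> v - u < d \<Longrightarrow> a \<le> u \<Longrightarrow> v \<le> b \<Longrightarrow>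
      f v - f u \<le> q * (v - u)"
    using assms(1) unfolding straddled_def slope_above_def by (meson not_le)
  \<comment> \<open>With a third, the length \<open>2 * e\<close> is strictly below both
    \<open>d\<close> and \<open>d'\<close>.\<close>
  define e where "e = min (min d d' / 3) (min (x - a) (b - x))"
  have "e > 0" using \<open>d > 0\<close> \<open>d' > 0\<close> assms by (simp add: e_def)
  have e: "3 * e \<le> d" "3 * e \<le> d'" "e \<le> x - a" "e \<le> b - x"
    by (simp_all add: e_def min_def)
  have "f (x + e) - f (x - e) \<le> q * (2 * e)"
    using d[of "x - e" "x + e"] e \<open>e > 0\<close> by simp
  also have "\<dots> < r * (2 * e)"
    using \<open>q < r\<close> \<open>e > 0\<close> by simp
  finally show "\<exists>u v. u < x \<and> x < v \<and> v - u < d' \<and> slope_above (\<lambda>x. - f x) a b (- r) u v"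
    using e \<open>e > 0\<close> by (intro exI[of _ "x - e"] exI[of _ "x + e"]) (auto simp: slope_above_def)
qed

text \<open>The derivative is the supremum \<open>D\<close> of the slopes exceeded by arbitrarily
  short intervals around \<open>x\<close>. Slopes above \<open>D\<close> are excluded by its choice,
  slopes below \<open>D\<close> by \<open>rat\<close>; the bounds \<open>m\<close> and
  \<open>n\<close> make \<open>D\<close> finite.\<close>

lemma differentiable_if_slopes_agree:
  fixes f :: "real \<Rightarrow> real"
  assumes f: "isCont f x" and x: "a < x" "x < b"
    and "\<not> straddled (slope_above f a b m) x" "\<not> straddled (slope_above (\<lambda>x. - f x) a b n) x"
    and rat: "\<And>p q. p \<in> \<rat> \<Longrightarrow> q \<in> \<rat> \<Longrightarrow> p < q \<Longrightarrow> \<not> (straddled (slope_above f a b q) x \<and>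
      straddled (slope_above (\<lambda>x. - f x) a b (- p)) x)"
  shows "f differentiable at x"
proof -
  define A where "A = {q. straddled (slope_above f a b q) x}"
  define D where "D = Sup A"
  have down: "p \<in> A" if "q \<in> A" "p \<le> q" for p q
    using that slope_above_mono unfolding A_def by (auto elim!: straddled_mono)
  have "bdd_above A"
  proof (rule bdd_aboveI)
    show "q \<le> m" if "q \<in> A" for q
      using down[OF that, of m] assms(4) by (force simp: A_def)
  qed
  \<comment> \<open>Otherwise \<open>straddled_uminus\<close> would give \<open>- f\<close> slopes
    above \<open>n\<close> at all scales.\<close>
  have "- (n + 1) \<in> A"
    using straddled_uminus[of f a b "- (n + 1)" x "- n"] assms(5) x by (auto simp: A_def)
  have upper: "\<not> straddled (slope_above f a b q) x" if "D < q" for q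
    using cSup_upper[OF _ \<open>bdd_above A\<close>, of q] that by (auto simp: A_def D_def)
  have lower: "\<not> straddled (slope_above (\<lambda>x. - f x) a b (- p)) x" if "p < D" for p
  proof
    assume *: "straddled (slope_above (\<lambda>x. - f x) a b (- p)) x"
    have "\<exists>q\<in>A. p < q"
      using less_cSupD[of A p] \<open>- (n + 1) \<in> A\<close> that unfolding D_def by blast
    then obtain q where "q \<in> A" "p < q" ..
    \<comment> \<open>As \<open>rat\<close> concerns rational slopes only, both bounds are moved
      inwards to rationals \<open>p1 < q1\<close>.\<close>
    then obtain q1 where q1: "q1 \<in> \<rat>" "p < q1" "q1 < q"
      using Rats_dense_in_real by blast
    then obtain p1 where p1: "p1 \<in> \<rat>" "p < p1" "p1 < q1"
      using Rats_dense_in_real by blast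
    have "straddled (slope_above (\<lambda>x. - f x) a b (- p1)) x"
      using p1 by (intro straddled_mono[OF *] slope_above_mono[of _ _ "- p1" "- p"]) auto
    moreover have "q1 \<in> A"
      using down[OF \<open>q \<in> A\<close>] q1 by simp
    ultimately show False
      using rat[OF p1(1) q1(1) p1(3)] by (simp add: A_def)
  qed
  have "((\<lambda>y. (f y - f x) / (y - x)) \<longlongrightarrow> D) (at x)"
  proof (rule tendstoI)
    fix e :: real assume "e > 0"
    obtain d1 where d1: "d1 > 0" "\<And>y. y \<noteq> x \<Longrightarrow> dist y x < d1 \<Longrightarrow> (f y - f x) / (y - x) \<le> D + e / 2"
      using quotient_le_of_straddling[OF f x upper[of "D + e / 2"]] \<open>e > 0\<close> by auto
    have "isCont (\<lambda>x. - f x) x" using f by simp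
    then obtain d2 where d2: "d2 > 0"
      "\<And>y. y \<noteq> x \<Longrightarrow> dist y x < d2 \<Longrightarrow> (- f y - - f x) / (y - x) \<le> - (D - e / 2)"
      using quotient_le_of_straddling[OF _ x lower[of "D - e / 2"]] \<open>e > 0\<close> by auto
    have "dist ((f y - f x) / (y - x)) D < e" if "y \<noteq> x" "dist y x < min d1 d2" for y
    proof -
      have "(- f y - - f x) / (y - x) = - ((f y - f x) / (y - x))"
        by (simp add: minus_divide_left)
      then show ?thesis
        using d1(2)[of y] d2(2)[of y] that \<open>e > 0\<close> by (simp add: dist_real_def abs_less_iff)
    qed
    then show "\<forall>\<^sub>F y in at x. dist ((f y - f x) / (y - x)) D < e"
      unfolding eventually_at using d1(1) d2(1) by (intro exI[of _ "min d1 d2"]) auto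
  qed
  then have "(f has_real_derivative D) (at x)"
    by (simp add: has_field_derivative_iff)
  then show ?thesis
    using real_differentiable_def by blast
qed

text \<open>Restricting to rational pairs of slopes keeps the exceptional set a countable union of
  null sets; the end points join it because continuity is available at interior points.\<close>

lemma abs_continuous_on_imp_differentiable_AE:
  assumes ac: "abs_continuous_on {a..b} f"
  shows "AE x in lebesgue. x \<in> {a..b} \<longrightarrow> f differentiable at x"
proof -
  let ?A = "\<lambda>f. {x. \<forall>n::nat. straddled (slope_above f a b (real n)) x}"
  let ?B = "\<lambda>p q. {x. straddled (slope_above f a b q) x \<and>
    straddled (slope_above (\<lambda>x. - f x) a b (- p)) x}"
  let ?Q = "{(p, q). p \<in> \<rat> \<and> q \<in> \<rat> \<and> p < (q::real)}"
  define N where "N = {a, b} \<union> ?A f \<union> ?A (\<lambda>x. - f x) \<union> (\<Union>(p, q)\<in>?Q. ?B p q)"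
  have "countable ?Q"
    by (rule countable_subset[of _ "\<rat> \<times> \<rat>"]) (auto simp: countable_rat)
  then have "negligible (\<Union>(p, q)\<in>?Q. ?B p q)"
    using negligible_different_slopes[OF ac] by (intro negligible_countable_Union) auto
  moreover have "negligible (?A f)" "negligible (?A (\<lambda>x. - f x))"
    using negligible_infinite_slope ac abs_continuous_on_uminus by blast+
  ultimately have "negligible N"
    unfolding N_def by (intro negligible_Un) auto
  moreover have "f differentiable at x" if xN: "x \<in> {a..b}" "x \<notin> N" for x
  proof -
    have x: "a < x" "x < b" using xN by (auto simp: N_def)
    obtain m n :: nat where "\<not> straddled (slope_above f a b m) x"
      "\<not> straddled (slope_above (\<lambda>x. - f x) a b n) x"
      using xN(2) unfolding N_def by blast
    then show ?thesis
      using xN(2) unfolding N_def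
      by (intro differentiable_if_slopes_agree[OF abs_continuous_on_imp_isCont[OF ac x] x]) blast+
  qed
  ultimately show ?thesis
    by (intro AE_I'[of N]) (auto simp: negligible_iff_null_sets)
qed

subsection \<open>Step functions of difference quotients\<close>

text \<open>There are \<open>Suc n\<close> cells, so \<open>n = 0\<close> involves no division by
  zero.\<close>

definition mesh :: "real \<Rightarrow> real \<Rightarrow> nat \<Rightarrow> real" where
  "mesh a b n = (b - a) / Suc n"

definition cell :: "real \<Rightarrow> real \<Rightarrow> nat \<Rightarrow> nat \<Rightarrow> real set" where
  "cell a b n k = {a + k * mesh a b n..a + (real k + 1) * mesh a b n}"

definition cell_index :: "real \<Rightarrow> real \<Rightarrow> nat \<Rightarrow> real \<Rightarrow> nat" where
  "cell_index a b n x = min (nat \<lfloor>(x - a) / mesh a b n\<rfloor>) n"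

text \<open>Increments are oriented as \<open>f(left) - f(right)\<close>, so this approximates \<open>- f'\<close>. The cap \<open>n\<close> in the
  index puts the right end point \<open>b\<close> into the last cell.\<close>

definition cell_quotient :: "(real \<Rightarrow> real) \<Rightarrow> real \<Rightarrow> real \<Rightarrow> nat \<Rightarrow> real \<Rightarrow> real" where
  "cell_quotient f a b n x = increment f (cell a b n (cell_index a b n x)) / mesh a b n"

lemma mesh_pos: "a < b \<Longrightarrow> mesh a b n > 0"
  by (simp add: mesh_def)

lemma mesh_tendsto_0: "mesh a b \<longlonglongrightarrow> 0"
  using tendsto_mult_right_zero[OF LIMSEQ_inverse_real_of_nat, of "b - a"]
  by (simp add: mesh_def[abs_def] field_simps)

lemma increment_cell:
  "a < b \<Longrightarrow> increment f (cell a b n k) = f (a + k * mesh a b n) - f (a + (real k + 1) * mesh a b n)"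
  using mesh_pos[of a b n] by (simp add: cell_def increment_Icc mult_right_mono)

lemma measure_cell: "a < b \<Longrightarrow> measure lborel (cell a b n k) = mesh a b n"
  using mesh_pos[of a b n] by (simp add: cell_def algebra_simps)

lemma mem_cell_index:
  assumes "a < b" "x \<in> {a..b}"
  shows "x \<in> cell a b n (cell_index a b n x)"
proof -
  define y where "y = (x - a) / mesh a b n"
  have h: "mesh a b n > 0" using assms mesh_pos by blast
  have x: "x = a + y * mesh a b n" using h by (simp add: y_def)
  have y0: "0 \<le> y" using assms h by (simp add: y_def)
  have "(x - a) * Suc n \<le> (b - a) * Suc n"
    using assms by (intro mult_right_mono) auto
  then have yn: "y \<le> n + 1"
    using assms by (simp add: y_def mesh_def field_simps)
  have i: "cell_index a b n x = min (nat \<lfloor>y\<rfloor>) n"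
    by (simp add: cell_index_def y_def)
  have "real (nat \<lfloor>y\<rfloor>) \<le> y" "y < real (nat \<lfloor>y\<rfloor>) + 1"
    using y0 by linarith+
  \<comment> \<open>The cap acts only if \<open>y \<ge> n + 1\<close>; then \<open>yn\<close> forces
    \<open>y = n + 1\<close>, that is, \<open>x = b\<close>.\<close>
  then have "real (cell_index a b n x) \<le> y" "y \<le> real (cell_index a b n x) + 1"
    using yn unfolding i by (auto simp: min_def)
  then have "cell_index a b n x * mesh a b n \<le> y * mesh a b n"
    "y * mesh a b n \<le> (real (cell_index a b n x) + 1) * mesh a b n"
    using h by (intro mult_right_mono; simp)+
  moreover have "y * mesh a b n = x - a" using x by simp
  ultimately show ?thesis
    by (simp add: cell_def algebra_simps)
qed

lemma cell_subset:
  assumes "a < b" "k \<le> n"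
  shows "cell a b n k \<subseteq> {a..b}"
proof -
  have "(real k + 1) * mesh a b n \<le> (real n + 1) * mesh a b n"
    using assms mesh_pos[of a b n] by (intro mult_right_mono) auto
  also have "\<dots> = b - a"
    by (simp add: mesh_def field_simps)
  finally show ?thesis
    using mesh_pos[OF assms(1), of n] by (auto simp: cell_def intro: order_trans[rotated])
qed

text \<open>This turns the sum over a set of cells in \<open>V_phi\<close> into a sum over
  indices.\<close>

lemma inj_cell: "a < b \<Longrightarrow> inj (cell a b n)"
proof (rule injI)
  fix i j assume "a < b" and eq: "cell a b n i = cell a b n j"
  have "Inf (cell a b n k) = a + k * mesh a b n" for k
    using mesh_pos[OF \<open>a < b\<close>, of n] by (simp add: cell_def mult_right_mono)
  then have "a + i * mesh a b n = a + j * mesh a b n"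
    using eq by metis
  then show "i = j"
    using mesh_pos[OF \<open>a < b\<close>, of n] by simp
qed

lemma cells_in_partitions:
  assumes "a < b"
  shows "cell a b n ` {..n} \<in> partitions {a..b}"
proof -
  note h = mesh_pos[OF assms, of n]
  have "interior (cell a b n i) \<inter> interior (cell a b n j) = {}" if "i < j" for i j
  proof -
    have "(real i + 1) * mesh a b n \<le> real j * mesh a b n"
      using that h by (intro mult_right_mono) auto
    then show ?thesis by (auto simp: cell_def)
  qed
  then have disj: "interior (cell a b n i) \<inter> interior (cell a b n j) = {}" if "i \<noteq> j" for i j
    using that by (metis Int_commute linorder_neqE_nat)
  have "cell a b n ` {..n} division_of {a..b}"
  proof (rule division_ofI)
    fix K assume K: "K \<in> cell a b n ` {..n}"
    then obtain k where k: "K = cell a b n k" "k \<le> n" by auto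
    show "K \<subseteq> {a..b}" using k cell_subset[OF assms] by blast
    show "K \<noteq> {}" using h k by (simp add: cell_def)
    show "\<exists>u v. K = cbox u v" using k by (auto simp: cell_def)
    fix L assume L: "L \<in> cell a b n ` {..n}" "K \<noteq> L"
    then obtain l where l: "L = cell a b n l" by auto
    with L(2) k(1) have "k \<noteq> l" by auto
    then show "interior K \<inter> interior L = {}"
      using disj k(1) l by simp
  next
    have "x \<in> \<Union>(cell a b n ` {..n})" if "x \<in> {a..b}" for x
      using mem_cell_index[OF assms that, of n] by (auto simp: cell_index_def)
    then show "\<Union>(cell a b n ` {..n}) = {a..b}"
      using cell_subset[OF assms] by fast
  qed simp
  then show ?thesis
    using h by (auto simp: partitions_def measure_cell[OF assms])
qed

text \<open>The point \<open>x\<close> need not be an end point of its cell, but it lies between the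
  two. The errors of the linear approximation at both ends are proportional to their distances from
  \<open>x\<close>, which add up to the mesh.\<close>

lemma cell_quotient_tendsto:
  assumes "a < b" "x \<in> {a..b}" and f: "(f has_real_derivative D) (at x)"
  shows "(\<lambda>n. cell_quotient f a b n x) \<longlonglongrightarrow> - D"
proof (rule LIMSEQ_I)
  fix e :: real assume "e > 0"
  have "(f has_derivative (*) D) (at x)"
    using f by (simp add: has_field_derivative_def)
  then obtain d where "d > 0" and d: "\<And>y. norm (y - x) < d \<Longrightarrow>
      norm (f y - f x - D * (y - x)) \<le> e / 2 * norm (y - x)"
    unfolding has_derivative_at_alt using \<open>e > 0\<close> by (meson half_gt_zero)
  have "eventually (\<lambda>n. mesh a b n < d) sequentially"
    using order_tendstoD(2)[OF mesh_tendsto_0 \<open>d > 0\<close>] .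
  then obtain N where N: "\<And>n. n \<ge> N \<Longrightarrow> mesh a b n < d"
    by (auto simp: eventually_sequentially)
  have "norm (cell_quotient f a b n x - - D) < e" if "n \<ge> N" for n
  proof -
    let ?h = "mesh a b n"
    have h: "?h > 0" "?h < d" using mesh_pos[OF assms(1)] N[OF that] by auto
    define u where "u = a + cell_index a b n x * ?h"
    have v: "a + (real (cell_index a b n x) + 1) * ?h = u + ?h"
      by (simp add: u_def algebra_simps)
    have x: "u \<le> x" "x \<le> u + ?h"
      using mem_cell_index[OF assms(1,2), of n] v unfolding cell_def u_def by auto
    have "\<bar>f u - f x - D * (u - x)\<bar> \<le> e / 2 * (x - u)"
      using d[of u] x h by simp
    moreover have "\<bar>f (u + ?h) - f x - D * (u + ?h - x)\<bar> \<le> e / 2 * (u + ?h - x)"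
      using d[of "u + ?h"] x h by simp
    moreover have "e / 2 * (x - u) + e / 2 * (u + ?h - x) = e / 2 * ?h"
      by (simp flip: distrib_left)
    moreover have "f u - f (u + ?h) + D * ?h
        = (f u - f x - D * (u - x)) - (f (u + ?h) - f x - D * (u + ?h - x))"
      by (simp add: algebra_simps)
    ultimately have *: "\<bar>f u - f (u + ?h) + D * ?h\<bar> \<le> e / 2 * ?h"
      by linarith
    have "cell_quotient f a b n x - - D = (f u - f (u + ?h) + D * ?h) / ?h"
      using h increment_cell[OF assms(1), of f n "cell_index a b n x"]
      unfolding v u_def[symmetric] cell_quotient_def by (simp add: add_divide_distrib)
    then have "\<bar>cell_quotient f a b n x - - D\<bar> \<le> e / 2"
      using * h by (simp add: abs_divide pos_divide_le_eq)
    then show ?thesis using \<open>e > 0\<close> by simp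
  qed
  then show "\<exists>N. \<forall>n\<ge>N. norm (cell_quotient f a b n x - - D) < e" by blast
qed

text \<open>The quotient depends on \<open>x\<close> only through an integer part, and every
  function of an integer is measurable.\<close>

lemma borel_measurable_cell_quotient: "cell_quotient f a b n \<in> borel_measurable borel"
proof -
  have "(\<lambda>x. \<lfloor>(x - a) / mesh a b n\<rfloor>) \<in> borel \<rightarrow>\<^sub>M count_space UNIV"
    by measurable
  then have "(\<lambda>x. (\<lambda>i. increment f (cell a b n (min (nat i) n)) / mesh a b n)
      \<lfloor>(x - a) / mesh a b n\<rfloor>) \<in> borel_measurable borel"
    by (rule measurable_compose) simp
  then show ?thesis
    by (simp add: cell_quotient_def[abs_def] cell_index_def)
qed

lemma borel_measurable_lebesgue_onI:
  "g \<in> borel_measurable borel \<Longrightarrow> g \<in> borel_measurable (lebesgue_on S)"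
  by (intro measurable_restrict_space1 measurable_completion) simp

text \<open>On each cell the integrand is at most the constant \<open>C k\<close>, and the integral
  of these constants is the sum that the uniform partition contributes to
  \<open>V_phi\<close>.\<close>

lemma nn_integral_cell_quotient_le_V_phi:
  assumes "a < b"
  shows "(\<integral>\<^sup>+x. \<phi> x \<bar>cell_quotient f a b n x\<bar> \<partial>lebesgue_on {a..b}) \<le> V_phi \<phi> {a..b} f"
proof -
  let ?K = "cell a b n" and ?h = "mesh a b n"
  define C where "C k = phi_plus \<phi> (?K k) (\<bar>increment f (?K k)\<bar> / ?h)" for k
  note h = mesh_pos[OF assms, of n]
  \<comment> \<open>Adjacent cells share an end point, where the sum has two terms; the inequality
    keeps only the one of the chosen cell.\<close>
  have le: "\<phi> x \<bar>cell_quotient f a b n x\<bar> \<le> (\<Sum>k\<le>n. C k * indicator (?K k) x)" if "x \<in> {a..b}" for x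
  proof -
    let ?i = "cell_index a b n x"
    have x: "x \<in> ?K ?i" using mem_cell_index[OF assms that] .
    have "\<phi> x \<bar>cell_quotient f a b n x\<bar> \<le> C ?i"
      using x h unfolding C_def phi_plus_def cell_quotient_def
      by (intro SUP_upper2[of x]) (auto simp: abs_divide)
    also have "\<dots> = C ?i * indicator (?K ?i) x" using x by simp
    also have "\<dots> \<le> (\<Sum>k\<le>n. C k * indicator (?K k) x)"
      by (rule member_le_sum) (auto simp: cell_index_def)
    finally show ?thesis .
  qed
  have K: "?K k \<in> sets (lebesgue_on {a..b})" "emeasure (lebesgue_on {a..b}) (?K k) = ennreal ?h"
    if "k \<le> n" for k
  proof -
    have sub: "?K k \<subseteq> {a..b}" using cell_subset[OF assms that] .
    have "?K k \<in> sets lebesgue" by (simp add: cell_def)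
    then show "?K k \<in> sets (lebesgue_on {a..b})"
      using sub by (simp add: sets_restrict_space_iff)
    have "emeasure (lebesgue_on {a..b}) (?K k) = emeasure lborel (?K k)"
      using sub by (simp add: emeasure_restrict_space cell_def)
    also have "\<dots> = ennreal (measure lborel (?K k))"
      by (rule emeasure_eq_ennreal_measure) (simp add: cell_def emeasure_lborel_Icc_eq)
    also have "\<dots> = ennreal ?h"
      by (simp add: measure_cell[OF assms])
    finally show "emeasure (lebesgue_on {a..b}) (?K k) = ennreal ?h" .
  qed
  have "(\<integral>\<^sup>+x. \<phi> x \<bar>cell_quotient f a b n x\<bar> \<partial>lebesgue_on {a..b})
      \<le> (\<integral>\<^sup>+x. (\<Sum>k\<le>n. C k * indicator (?K k) x) \<partial>lebesgue_on {a..b})"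
    using le by (intro nn_integral_mono) simp
  also have "\<dots> = (\<Sum>k\<le>n. \<integral>\<^sup>+x. C k * indicator (?K k) x \<partial>lebesgue_on {a..b})"
    using K by (intro nn_integral_sum) auto
  also have "\<dots> = (\<Sum>k\<le>n. C k * ennreal ?h)"
    using K by (intro sum.cong) (auto simp: nn_integral_cmult_indicator)
  also have "\<dots> = (\<Sum>K\<in>?K ` {..n}.
      phi_plus \<phi> K (\<bar>increment f K\<bar> / measure lborel K) * ennreal (measure lborel K))"
    using inj_cell[OF assms, of n]
    by (subst sum.reindex) (auto simp: C_def measure_cell[OF assms] inj_on_def)
  also have "\<dots> \<le> V_phi \<phi> {a..b} f"
    unfolding V_phi_def by (intro SUP_upper cells_in_partitions assms)
  finally show ?thesis .
qed

section \<open>The modular of the derivative and the norm inequality\<close>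

lemma borel_measurable_deriv_abs_continuous:
  assumes "a < b" and ac: "abs_continuous_on {a..b} f"
  shows "deriv f \<in> borel_measurable (lebesgue_on {a..b})"
proof -
  \<comment> \<open>Where the quotients diverge, \<open>lim\<close> takes an unspecified value. This
    happens only on a null set, and completeness of Lebesgue measure transfers measurability from
    \<open>?g\<close> to the derivative.\<close>
  let ?g = "\<lambda>x. if x \<in> {a..b} then - lim (\<lambda>n. cell_quotient f a b n x) else 0"
  have "(\<lambda>x. - lim (\<lambda>n. cell_quotient f a b n x)) \<in> borel_measurable (lebesgue_on {a..b})"
    by (intro borel_measurable_uminus borel_measurable_lim_metric
        borel_measurable_lebesgue_onI borel_measurable_cell_quotient)
  then have g: "?g \<in> borel_measurable lebesgue"
    by (subst borel_measurable_if) auto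
  have "AE x in lebesgue. ?g x = (if x \<in> {a..b} then deriv f x else 0)"
    using abs_continuous_on_imp_differentiable_AE[OF ac]
  proof eventually_elim
    case (elim x)
    show ?case
    proof (cases "x \<in> {a..b}")
      case True
      then have "(\<lambda>n. cell_quotient f a b n x) \<longlonglongrightarrow> - deriv f x"
        using elim assms(1) by (intro cell_quotient_tendsto) (auto simp: DERIV_deriv_iff_real_differentiable)
      then show ?thesis using True by (simp add: limI)
    qed auto
  qed
  then have "(\<lambda>x. if x \<in> {a..b} then deriv f x else 0) \<in> borel_measurable lebesgue"
    by (rule borel_measurable_AE[OF g])
  then show ?thesis
    by (subst (asm) borel_measurable_if) auto
qed

text \<open>The loss from \<open>c\<close> to \<open>c'\<close> makes up for the missing left-continuity of \<open>\<phi> x\<close>: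
  once the difference quotients are close to the derivative, they exceed \<open>c' / c\<close> times
  its absolute value.\<close>

lemma modular_deriv_le_V_phi:
  assumes "a < b" and \<phi>: "\<phi> \<in> Phi_w {a..b}" and ac: "abs_continuous_on {a..b} f"
    and c: "0 < c'" "c' < c"
  shows "modular \<phi> {a..b} (\<lambda>x. c' * deriv f x) \<le> V_phi \<phi> {a..b} (\<lambda>x. c * f x)"
proof -
  let ?M = "lebesgue_on {a..b}" and ?q = "cell_quotient (\<lambda>x. c * f x) a b"
  have meas: "(\<lambda>x. \<phi> x \<bar>?q n x\<bar>) \<in> borel_measurable ?M" for n
    using \<phi> borel_measurable_lebesgue_onI[OF borel_measurable_cell_quotient]
    unfolding Phi_w_def by blast
  have "AE x in ?M. f differentiable at x"
    using abs_continuous_on_imp_differentiable_AE[OF ac] by (subst AE_restrict_space_iff) auto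
  then have "AE x in ?M. \<phi> x \<bar>c' * deriv f x\<bar> \<le> liminf (\<lambda>n. \<phi> x \<bar>?q n x\<bar>)"
    using AE_space
  proof eventually_elim
    case (elim x)
    then have x: "x \<in> {a..b}" by simp
    with \<phi> have mono: "mono_on {0..} (\<phi> x)" and zero: "\<phi> x 0 = 0"
      by (auto simp: Phi_w_def)
    show ?case
    proof (cases "deriv f x = 0")
      \<comment> \<open>The strict inequality used in the other case fails here, but the left side
        is \<open>\<phi> x 0 = 0\<close>.\<close>
      case True
      then show ?thesis by (simp add: zero)
    next
      case False
      have "(f has_real_derivative deriv f x) (at x)"
        using elim by (simp add: DERIV_deriv_iff_real_differentiable)
      then have "((\<lambda>x. c * f x) has_real_derivative c * deriv f x) (at x)"
        by (rule DERIV_cmult)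
      from cell_quotient_tendsto[OF assms(1) x this]
      have "(\<lambda>n. \<bar>?q n x\<bar>) \<longlonglongrightarrow> \<bar>- (c * deriv f x)\<bar>"
        by (rule tendsto_rabs)
      moreover have "\<bar>c' * deriv f x\<bar> < \<bar>- (c * deriv f x)\<bar>"
        using c False by (simp add: abs_mult)
      ultimately have "eventually (\<lambda>n. \<bar>c' * deriv f x\<bar> < \<bar>?q n x\<bar>) sequentially"
        by (rule order_tendstoD)
      then have "eventually (\<lambda>n. \<phi> x \<bar>c' * deriv f x\<bar> \<le> \<phi> x \<bar>?q n x\<bar>) sequentially"
        by eventually_elim (intro mono_onD[OF mono], auto)
      then show ?thesis by (rule Liminf_bounded)
    qed
  qed
  then have "modular \<phi> {a..b} (\<lambda>x. c' * deriv f x) \<le> (\<integral>\<^sup>+x. liminf (\<lambda>n. \<phi> x \<bar>?q n x\<bar>) \<partial>?M)"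
    unfolding modular_def by (rule nn_integral_mono_AE)
  also have "\<dots> \<le> liminf (\<lambda>n. \<integral>\<^sup>+x. \<phi> x \<bar>?q n x\<bar> \<partial>?M)"
    using meas by (rule nn_integral_liminf)
  also have "\<dots> \<le> liminf (\<lambda>n::nat. V_phi \<phi> {a..b} (\<lambda>x. c * f x))"
    using nn_integral_cell_quotient_le_V_phi[OF assms(1)] by (intro Liminf_mono) simp
  also have "\<dots> = V_phi \<phi> {a..b} (\<lambda>x. c * f x)"
    by (simp add: Liminf_const)
  finally show ?thesis .
qed

theorem theorem6p2:
  fixes a b :: real and \<phi> :: "real \<Rightarrow> real \<Rightarrow> ennreal" and f :: "real \<Rightarrow> real"
  assumes "a < b"
    and "\<phi> \<in> Phi_w {a..b}"
    and "f \<in> RBV \<phi> {a..b}"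
    and "abs_continuous_on {a..b} f"
  shows "deriv f \<in> L_phi \<phi> {a..b} \<and> norm_L_phi \<phi> {a..b} (deriv f) \<le> norm_RBV \<phi> {a..b} f"
proof
  note key = modular_deriv_le_V_phi[OF assms(1,2,4)]
  have "((\<lambda>c. V_phi \<phi> {a..b} (\<lambda>x. c * f x)) \<longlongrightarrow> 0) (at_right 0)"
    using assms(3) by (auto simp: RBV_def filterlim_at_split)
  \<comment> \<open>The bound \<open>key\<close> demands a strictly larger factor on the side of
    \<open>f\<close>; the factor 2 provides it and preserves the limit at 0.\<close>
  moreover have "filterlim (\<lambda>c::real. 2 * c) (at_right 0) (at_right 0)"
    using filterlim_times_pos[of "\<lambda>c::real. c" 0 "at_right 0" 2] by (simp add: filterlim_ident)
  ultimately have V: "((\<lambda>c. V_phi \<phi> {a..b} (\<lambda>x. 2 * c * f x)) \<longlongrightarrow> 0) (at_right 0)"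
    by (rule filterlim_compose)
  have "eventually (\<lambda>c::real. 0 < c) (at_right 0)"
    by (rule eventually_at_right_less)
  then have "\<forall>\<^sub>F c in at_right 0. modular \<phi> {a..b} (\<lambda>x. c * deriv f x)
      \<le> V_phi \<phi> {a..b} (\<lambda>x. 2 * c * f x)"
    by eventually_elim (rule key, auto)
  then have "((\<lambda>c. modular \<phi> {a..b} (\<lambda>x. c * deriv f x)) \<longlongrightarrow> 0) (at_right 0)"
    by (intro tendsto_sandwich[OF _ _ tendsto_const V]) auto
  then show "deriv f \<in> L_phi \<phi> {a..b}"
    using borel_measurable_deriv_abs_continuous[OF assms(1,4)] by (simp add: L_phi_def)
  \<comment> \<open>For the same reason \<open>c\<close> is first enlarged to \<open>c + e\<close>,
    so that \<open>1 / (c + e) < 1 / c\<close>, and \<open>e\<close> is then arbitrary.\<close>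
  have "norm_L_phi \<phi> {a..b} (deriv f) \<le> ennreal c"
    if c: "c > 0" "V_phi \<phi> {a..b} (\<lambda>x. f x / c) \<le> 1" for c
  proof (rule ennreal_le_epsilon)
    fix e :: real assume "e > 0"
    have "modular \<phi> {a..b} (\<lambda>x. 1 / (c + e) * deriv f x) \<le> V_phi \<phi> {a..b} (\<lambda>x. 1 / c * f x)"
      using c \<open>e > 0\<close> by (intro key) (auto simp: frac_less2)
    then have "modular \<phi> {a..b} (\<lambda>x. deriv f x / (c + e)) \<le> 1"
      using c(2) by simp
    then have "norm_L_phi \<phi> {a..b} (deriv f) \<le> ennreal (c + e)"
      using c \<open>e > 0\<close> unfolding norm_L_phi_def
      by (intro Inf_lower CollectI exI[of _ "c + e"]) (simp del: ennreal_plus)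
    then show "norm_L_phi \<phi> {a..b} (deriv f) \<le> ennreal c + ennreal e"
      using c \<open>e > 0\<close> by (simp add: ennreal_plus)
  qed
  then show "norm_L_phi \<phi> {a..b} (deriv f) \<le> norm_RBV \<phi> {a..b} f"
    unfolding norm_RBV_def by (intro Inf_greatest) auto
qed

end
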